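(* The mapping $\gamma_P$ is a reciprocal conjugation, in the sense of Dean and van Lamoen, with pole $P_0=Q^2$, the point whose barycentric coordinates with respect to $ABC$ are the squares of the barycentric coordinates of $Q$.
   Context: We work in the Euclidean plane extended by its line at infinity $l_\infty$; affine maps are extended to $l_\infty$. $ABC$ is an ordinary non-degenerate triangle; its sides are the lines $BC, CA, AB$. $X_1X_2\cdot Y_1Y_2$ denotes the intersection of two lines. $K$ is the complement map (homothety with center the centroid $G$ and ratio $-1/2$); $K^{-1}(ABC)$ is the anticomplementary triangle. $\iota$ is the isotomic map, $(x:y:z)\mapsto(1/x:1/y:1/z)$ in barycentric coordinates. $P$ is a point not on the sides of $ABC$ or $K^{-1}(ABC)$; $P'=\iota(P)$, $Q=K(P')$, and $D=AP\cdot BC$, $E=BP\cdot CA$, $F=CP\cdot AB$. Generalized isogonal map $\gamma_P$: let $h_a$ be the affine reflection about the line $AQ$ in the direction of $EF$ (i.e. $h_a(X)=X'$ with $XX'\parallel EF$ and the midpoint of $XX'$ on $AQ$), $h_b$ the affine reflection about $BQ$ in the direction $DF$, and $h_c$ the affine reflection about $CQ$ in the direction $DE$. For $X\neq A,B,C$, $\gamma_P(X)$ is the common point of the lines $Ah_a(X),Bh_b(X),Ch_c(X)$ (which are concurrent). The reciprocal conjugation (Dean and van Lamoen) with pole $P_0=(l:m:n)$, $lmn\neq 0$ (barycentric coordinates with respect to $ABC$), is the map $(r:s:t)\mapsto\left(\frac{l}{r}:\frac{m}{s}:\frac{n}{t}\right)$ on points not on the sides of $ABC$. *)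

theory Defs
  imports "HOL-Analysis.Analysis"
begin

text \<open>
  The Euclidean plane is \<open>real^2\<close>. A point of the plane extended by its line at
  infinity is a one-dimensional subspace of \<open>real^2 \<times> real\<close>: the ordinary point \<open>a\<close>
  is the subspace spanned by \<open>(a, 1)\<close>, and the point at infinity in the direction
  \<open>d \<noteq> 0\<close> is the subspace spanned by \<open>(d, 0)\<close>.
\<close>

typedef epoint = "{span {v} | v :: (real^2) \<times> real. v \<noteq> 0}"
proof -
  have "((0 :: real^2), (1 :: real)) \<noteq> 0"
    by (simp add: zero_prod_def)
  then show ?thesis
    by blast
qed

definition ordinary :: "real^2 \<Rightarrow> epoint" where
  "ordinary a = Abs_epoint (span {(a, 1)})"

definition line_at_infinity :: "epoint set" where
  "line_at_infinity = {X. \<forall>v \<in> Rep_epoint X. snd v = 0}"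

text \<open>The line through \<open>X\<close> and \<open>Y\<close>, meaningful for \<open>X \<noteq> Y\<close>.\<close>

definition join :: "epoint \<Rightarrow> epoint \<Rightarrow> epoint set" where
  "join X Y = {Z. Rep_epoint Z \<subseteq> span (Rep_epoint X \<union> Rep_epoint Y)}"

definition meet :: "epoint set \<Rightarrow> epoint set \<Rightarrow> epoint" where
  "meet l m = (THE Z. Z \<in> l \<and> Z \<in> m)"

text \<open>Parallelism of lines other than the line at infinity; a line is parallel to itself.\<close>

definition parallel :: "epoint set \<Rightarrow> epoint set \<Rightarrow> bool" where
  "parallel l m \<longleftrightarrow> l \<inter> m \<inter> line_at_infinity \<noteq> {}"

text \<open>
  Extension of an injective affine map \<open>f\<close> to the line at infinity. The linear part of
  \<open>f\<close> is \<open>\<lambda>x. f x - f 0\<close>, so that \<open>(x, 1)\<close> is sent to \<open>(f x, 1)\<close> and \<open>(d, 0)\<close> to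
  \<open>(f d - f 0, 0)\<close>.
\<close>

definition affine_ext :: "(real^2 \<Rightarrow> real^2) \<Rightarrow> epoint \<Rightarrow> epoint" where
  "affine_ext f X =
     Abs_epoint ((\<lambda>(x, w). (f x - f 0 + w *\<^sub>R f 0, w)) ` Rep_epoint X)"

text \<open>
  The affine reflection about the line \<open>m\<close> in the direction of the line \<open>n\<close>. The
  disjunct \<open>x' = x\<close> covers the points of \<open>m\<close>, for which the line \<open>x x'\<close> degenerates.
\<close>

definition affine_reflection :: "epoint set \<Rightarrow> epoint set \<Rightarrow> real^2 \<Rightarrow> real^2" where
  "affine_reflection m n x =
     (THE x'. (x' = x \<or> parallel (join (ordinary x) (ordinary x')) n) \<and>
              ordinary (midpoint x x') \<in> m)"

definition sides :: "real^2 \<Rightarrow> real^2 \<Rightarrow> real^2 \<Rightarrow> epoint set" where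
  "sides A B C = join (ordinary B) (ordinary C) \<union> join (ordinary C) (ordinary A)
                   \<union> join (ordinary A) (ordinary B)"

text \<open>
  \<open>X = (x : y : z)\<close> in homogeneous barycentric coordinates with respect to \<open>A B C\<close>. The
  points at infinity are those with \<open>x + y + z = 0\<close>. The triple \<open>(0, 0, 0)\<close> is
  excluded automatically, since \<open>Rep_epoint X\<close> is one-dimensional.
\<close>

definition barycentric ::
  "real^2 \<Rightarrow> real^2 \<Rightarrow> real^2 \<Rightarrow> epoint \<Rightarrow> real \<Rightarrow> real \<Rightarrow> real \<Rightarrow> bool" where
  "barycentric A B C X x y z \<longleftrightarrow>
     Rep_epoint X = span {x *\<^sub>R (A, 1) + y *\<^sub>R (B, 1) + z *\<^sub>R (C, 1)}"

definition complement :: "real^2 \<Rightarrow> real^2 \<Rightarrow> real^2 \<Rightarrow> real^2 \<Rightarrow> real^2" where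
  "complement A B C x =
     (let G = (1/3) *\<^sub>R (A + B + C) in G + (- 1/2) *\<^sub>R (x - G))"

definition anticomplementary_sides :: "real^2 \<Rightarrow> real^2 \<Rightarrow> real^2 \<Rightarrow> epoint set" where
  "anticomplementary_sides A B C =
     (let K' = inv (complement A B C) in sides (K' A) (K' B) (K' C))"

text \<open>Used only for points off the sides of \<open>A B C\<close>, where \<open>x y z \<noteq> 0\<close>.\<close>

definition isotomic :: "real^2 \<Rightarrow> real^2 \<Rightarrow> real^2 \<Rightarrow> epoint \<Rightarrow> epoint" where
  "isotomic A B C X =
     (THE Y. \<exists>x y z. barycentric A B C X x y z \<and> barycentric A B C Y (1/x) (1/y) (1/z))"

definition barycentric_square :: "real^2 \<Rightarrow> real^2 \<Rightarrow> real^2 \<Rightarrow> epoint \<Rightarrow> epoint" where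
  "barycentric_square A B C X =
     (THE Y. \<exists>x y z. barycentric A B C X x y z \<and> barycentric A B C Y (x^2) (y^2) (z^2))"

definition traceD :: "real^2 \<Rightarrow> real^2 \<Rightarrow> real^2 \<Rightarrow> epoint \<Rightarrow> epoint" where
  "traceD A B C P = meet (join (ordinary A) P) (join (ordinary B) (ordinary C))"

definition traceE :: "real^2 \<Rightarrow> real^2 \<Rightarrow> real^2 \<Rightarrow> epoint \<Rightarrow> epoint" where
  "traceE A B C P = meet (join (ordinary B) P) (join (ordinary C) (ordinary A))"

definition traceF :: "real^2 \<Rightarrow> real^2 \<Rightarrow> real^2 \<Rightarrow> epoint \<Rightarrow> epoint" where
  "traceF A B C P = meet (join (ordinary C) P) (join (ordinary A) (ordinary B))"

definition pointQ :: "real^2 \<Rightarrow> real^2 \<Rightarrow> real^2 \<Rightarrow> epoint \<Rightarrow> epoint" where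
  "pointQ A B C P = affine_ext (complement A B C) (isotomic A B C P)"

definition reflA :: "real^2 \<Rightarrow> real^2 \<Rightarrow> real^2 \<Rightarrow> epoint \<Rightarrow> epoint \<Rightarrow> epoint" where
  "reflA A B C P = affine_ext (affine_reflection
     (join (ordinary A) (pointQ A B C P)) (join (traceE A B C P) (traceF A B C P)))"

definition reflB :: "real^2 \<Rightarrow> real^2 \<Rightarrow> real^2 \<Rightarrow> epoint \<Rightarrow> epoint \<Rightarrow> epoint" where
  "reflB A B C P = affine_ext (affine_reflection
     (join (ordinary B) (pointQ A B C P)) (join (traceD A B C P) (traceF A B C P)))"

definition reflC :: "real^2 \<Rightarrow> real^2 \<Rightarrow> real^2 \<Rightarrow> epoint \<Rightarrow> epoint \<Rightarrow> epoint" where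
  "reflC A B C P = affine_ext (affine_reflection
     (join (ordinary C) (pointQ A B C P)) (join (traceD A B C P) (traceE A B C P)))"

text \<open>\<open>Y\<close> lies on the three lines defining \<open>\<gamma>\<^sub>P(X)\<close>.\<close>

definition isogonal_common_point ::
  "real^2 \<Rightarrow> real^2 \<Rightarrow> real^2 \<Rightarrow> epoint \<Rightarrow> epoint \<Rightarrow> epoint \<Rightarrow> bool" where
  "isogonal_common_point A B C P X Y \<longleftrightarrow>
     Y \<in> join (ordinary A) (reflA A B C P X) \<and>
     Y \<in> join (ordinary B) (reflB A B C P X) \<and>
     Y \<in> join (ordinary C) (reflC A B C P X)"

definition generalized_isogonal ::
  "real^2 \<Rightarrow> real^2 \<Rightarrow> real^2 \<Rightarrow> epoint \<Rightarrow> epoint \<Rightarrow> epoint" where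
  "generalized_isogonal A B C P X = (THE Y. isogonal_common_point A B C P X Y)"

text \<open>
  \<open>f\<close> agrees, off the sides of \<open>A B C\<close>, with the reciprocal conjugation with pole \<open>P0\<close>.
\<close>

definition reciprocal_conjugation ::
  "real^2 \<Rightarrow> real^2 \<Rightarrow> real^2 \<Rightarrow> epoint \<Rightarrow> (epoint \<Rightarrow> epoint) \<Rightarrow> bool" where
  "reciprocal_conjugation A B C P0 f \<longleftrightarrow>
     (\<exists>l m n. l * m * n \<noteq> 0 \<and> barycentric A B C P0 l m n \<and>
        (\<forall>X r s t. X \<notin> sides A B C \<and> barycentric A B C X r s t \<longrightarrow>
           barycentric A B C (f X) (l/r) (m/s) (n/t)))"

end

theory Submission
  imports Defs
begin

text \<open>
  Write \<open>P = (p : q : r)\<close>. Then \<open>pqr \<noteq> 0\<close> because \<open>P\<close> is off the sides of \<open>ABC\<close>, and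
  \<open>q + r\<close>, \<open>r + p\<close>, \<open>p + q\<close> are nonzero because \<open>P\<close> is off the sides of the
  anticomplementary triangle. The complement map is \<open>(x : y : z) \<mapsto> (y + z : z + x : x + y)\<close>,
  so \<open>Q = (u : v : w)\<close> with \<open>u = p (q + r)\<close>, \<open>v = q (r + p)\<close>, \<open>w = r (p + q)\<close>.
  The line \<open>EF\<close> through \<open>E = (p : 0 : r)\<close> and \<open>F = (p : q : 0)\<close> meets the line at infinity
  in \<open>(p (q - r) : - v : w)\<close>, and the equation of \<open>AQ\<close> is \<open>w y = v z\<close>. Hence the reflection
  \<open>h\<^sub>a\<close>, which subtracts from a vector the multiple of this direction that changes the sign of
  \<open>w y - v z\<close>, sends \<open>(x : y : z)\<close> to a point \<open>(\<dots> : v z / w : w y / v)\<close>. A line through \<open>A\<close>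
  is determined by the ratio of the last two coordinates, so a point \<open>(x' : y' : z')\<close> is on
  \<open>A h\<^sub>a(X)\<close>, for \<open>X \<noteq> A\<close>, iff \<open>y y' / v\<^sup>2 = z z' / w\<^sup>2\<close> (lemma \<open>mem_join_reflA_iff\<close>).

  This condition is one third of a cyclically symmetric one: \<open>(x' : y' : z')\<close> is on all three
  lines iff \<open>x x' / u\<^sup>2 = y y' / v\<^sup>2 = z z' / w\<^sup>2\<close>. If at most one of \<open>x\<close>, \<open>y\<close>, \<open>z\<close> vanishes, that
  is, if \<open>X\<close> is not a vertex, the only solution up to a factor is
  \<open>(u\<^sup>2 y z : v\<^sup>2 z x : w\<^sup>2 x y)\<close> (lemma \<open>isogonal_common_point_iff\<close>); this is
  \<open>(u\<^sup>2 / x : v\<^sup>2 / y : w\<^sup>2 / z)\<close> when \<open>xyz \<noteq> 0\<close>, the reciprocal conjugate of \<open>X\<close>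
  with pole \<open>Q\<^sup>2\<close>.

  All computations take place with homogeneous vectors in \<open>real^2 \<times> real\<close>, so points at infinity
  (which \<open>P\<close>, \<open>Q\<close>, \<open>X\<close> and the common point may be) need no separate treatment. The statements
  for \<open>B\<close> and \<open>C\<close> are those for \<open>A\<close> in the triangles \<open>BCA\<close> and \<open>CAB\<close>.
\<close>

section \<open>Points and lines in homogeneous coordinates\<close>

definition hpoint :: "(real^2) \<times> real \<Rightarrow> epoint" where
  "hpoint v = Abs_epoint (span {v})"

lemma ordinary_eq_hpoint: "ordinary a = hpoint (a, 1)"
  by (simp add: ordinary_def hpoint_def)

lemma Rep_hpoint: "v \<noteq> 0 \<Longrightarrow> Rep_epoint (hpoint v) = span {v}"
  unfolding hpoint_def by (rule Abs_epoint_inverse) blast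

lemma hpoint_cases:
  obtains v where "v \<noteq> 0" "X = hpoint v"
proof -
  obtain v where "v \<noteq> 0" "Rep_epoint X = span {v}"
    using Rep_epoint[of X] by auto
  then show thesis
    using that by (metis Rep_epoint_inverse hpoint_def)
qed

lemma hpoint_eqD:
  assumes "hpoint v = hpoint w" "v \<noteq> 0" "w \<noteq> 0"
  obtains k where "k \<noteq> 0" "w = k *\<^sub>R v"
proof -
  have "w \<in> span {v}"
    using assms by (metis Rep_hpoint insertI1 span_base)
  then obtain k where "w = k *\<^sub>R v"
    by (auto simp: span_singleton)
  then show thesis
    using that assms(3) by fastforce
qed

lemma hpoint_scaleR: "k \<noteq> 0 \<Longrightarrow> hpoint (k *\<^sub>R v) = hpoint v"
proof -
  assume "k \<noteq> 0"
  then have "span {k *\<^sub>R v} = span {v}"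
    using span_image_scale[of "{v}" "\<lambda>_. k"] by simp
  then show ?thesis
    by (simp add: hpoint_def)
qed

lemma hpoint_mem_join_iff:
  assumes "u \<noteq> 0" "v \<noteq> 0" "w \<noteq> 0"
  shows "hpoint w \<in> join (hpoint u) (hpoint v) \<longleftrightarrow> (\<exists>i j. w = i *\<^sub>R u + j *\<^sub>R v)"
proof -
  have sp: "span (span {u} \<union> span {v}) = span {u, v}"
    by (simp only: insert_is_Un[of u "{v}"] span_Un span_span)
  have "hpoint w \<in> join (hpoint u) (hpoint v) \<longleftrightarrow> span {w} \<subseteq> span {u, v}"
    using assms by (simp add: join_def Rep_hpoint sp)
  also have "\<dots> \<longleftrightarrow> w \<in> span {u, v}"
    by (meson empty_subsetI insert_subset span_base span_minimal subset_iff subspace_span insertI1)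
  also have "\<dots> \<longleftrightarrow> (\<exists>i j. w = i *\<^sub>R u + j *\<^sub>R v)"
    unfolding span_insert[of u "{v}"] span_singleton
    by (simp add: image_iff diff_eq_eq add.commute)
  finally show ?thesis .
qed

lemma join_commute: "join X Y = join Y X"
  by (simp add: join_def Un_commute)

lemma hpoint_mem_line_at_infinity_iff:
  "v \<noteq> 0 \<Longrightarrow> hpoint v \<in> line_at_infinity \<longleftrightarrow> snd v = 0"
  by (auto simp: line_at_infinity_def Rep_hpoint span_singleton intro: exI[of _ 1])

lemma meet_eqI:
  assumes "Z \<in> l" "Z \<in> m" "\<And>Z'. Z' \<in> l \<Longrightarrow> Z' \<in> m \<Longrightarrow> Z' = Z"
  shows "meet l m = Z"
  unfolding meet_def using assms by blast

text \<open>
  On homogeneous vectors the extension of \<open>f\<close> is linear, so it is enough to find a linear map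
  that agrees with \<open>f\<close> at height 1.
\<close>

lemma affine_ext_hpoint:
  assumes "linear T" "\<And>x. T (x, 1) = (f x, 1)" "v \<noteq> 0"
  shows "affine_ext f (hpoint v) = hpoint (T v)"
proof -
  have "T (x, w) = (f x - f 0 + w *\<^sub>R f 0, w)" for x w
  proof -
    have "T (x, w) = T ((x, 1) - (0, 1) + w *\<^sub>R (0, 1))"
      by simp
    also have "\<dots> = T (x, 1) - T (0, 1) + w *\<^sub>R T (0, 1)"
      by (simp only: linear_add[OF assms(1)] linear_diff[OF assms(1)] linear_scale[OF assms(1)])
    finally show ?thesis
      by (simp add: assms(2))
  qed
  then have "(\<lambda>(x, w). (f x - f 0 + w *\<^sub>R f 0, w)) = T"
    by auto
  then show ?thesis
    using linear_span_image[OF assms(1), of "{v}"] assms(3)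
    by (simp add: affine_ext_def Rep_hpoint hpoint_def[of "T v"])
qed

section \<open>Affine reflections\<close>

text \<open>
  The axis \<open>m\<close> is the zero set of a linear functional \<open>\<phi>\<close>, and \<open>d\<close> spans the direction of \<open>n\<close>.
  The admissible images of \<open>x\<close> are the points \<open>x + t d\<close>, where \<open>t = 0\<close> is supplied by the disjunct
  \<open>x' = x\<close> of the definition; the midpoint condition \<open>\<phi> (x, 1) + t / 2 * \<phi> (d, 0) = 0\<close> is linear in
  \<open>t\<close>, and it determines \<open>t\<close> because the direction of \<open>n\<close> is not that of the axis.
\<close>

lemma affine_reflection_eq:
  fixes \<phi> :: "(real^2) \<times> real \<Rightarrow> real" and d :: "real^2"
  assumes \<phi>: "linear \<phi>" "\<phi> (d, 0) \<noteq> 0"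
    and m: "\<And>v. v \<noteq> 0 \<Longrightarrow> hpoint v \<in> m \<longleftrightarrow> \<phi> v = 0"
    and n: "n \<inter> line_at_infinity = {hpoint (d, 0)}"
  shows "affine_reflection m n x = x - (2 * \<phi> (x, 1) / \<phi> (d, 0)) *\<^sub>R d"
proof -
  have d: "(d, 0::real) \<noteq> 0"
    using \<phi> linear_0 by metis
  have par: "parallel (join (ordinary x) (ordinary x')) n \<longleftrightarrow> (\<exists>t. x' = x + t *\<^sub>R d)"
    if "x' \<noteq> x" for x'
  proof -
    have "parallel (join (ordinary x) (ordinary x')) n \<longleftrightarrow>
        hpoint (d, 0) \<in> join (ordinary x) (ordinary x')"
      by (simp add: parallel_def Int_assoc n)
    also have "\<dots> \<longleftrightarrow> (\<exists>i j. (d, 0) = i *\<^sub>R (x, 1) + j *\<^sub>R (x', 1::real))"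
      using d by (simp add: ordinary_eq_hpoint hpoint_mem_join_iff zero_prod_def)
    also have "\<dots> \<longleftrightarrow> (\<exists>t. x' = x + t *\<^sub>R d)"
    proof
      assume "\<exists>i j. (d, 0) = i *\<^sub>R (x, 1) + j *\<^sub>R (x', 1::real)"
      then obtain i j where ij: "d = i *\<^sub>R x + j *\<^sub>R x'" "i + j = 0"
        by auto
      then have i: "i = - j" by simp
      have "d = j *\<^sub>R (x' - x)"
        using ij(1) by (simp add: i algebra_simps)
      moreover have "j \<noteq> 0"
        using calculation d by (auto simp: zero_prod_def)
      ultimately have "x' = x + (1/j) *\<^sub>R d"
        by simp
      then show "\<exists>t. x' = x + t *\<^sub>R d" ..
    next
      assume "\<exists>t. x' = x + t *\<^sub>R d"
      then obtain t where t: "x' = x + t *\<^sub>R d" ..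
      then have "t \<noteq> 0"
        using that by auto
      then have "(d, 0) = (- 1/t) *\<^sub>R (x, 1) + (1/t) *\<^sub>R (x', 1::real)"
        by (simp add: t scaleR_add_right)
      then show "\<exists>i j. (d, 0) = i *\<^sub>R (x, 1) + j *\<^sub>R (x', 1::real)"
        by blast
    qed
    finally show ?thesis .
  qed
  have dir: "x' = x \<or> parallel (join (ordinary x) (ordinary x')) n \<longleftrightarrow> (\<exists>t. x' = x + t *\<^sub>R d)" for x'
    using par[of x'] by (cases "x' = x") (auto intro: exI[of _ 0])
  have mid: "ordinary (midpoint x (x + t *\<^sub>R d)) \<in> m \<longleftrightarrow> t = - 2 * \<phi> (x, 1) / \<phi> (d, 0)" for t
  proof -
    have eq: "(midpoint x (x + t *\<^sub>R d), 1) = (x, 1) + (t / 2) *\<^sub>R (d, 0::real)"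
      by (simp add: midpoint_def scaleR_add_right flip: scaleR_add_left)
    have "ordinary (midpoint x (x + t *\<^sub>R d)) \<in> m \<longleftrightarrow> \<phi> (midpoint x (x + t *\<^sub>R d), 1) = 0"
      by (simp add: ordinary_eq_hpoint m zero_prod_def)
    also have "\<dots> \<longleftrightarrow> \<phi> (x, 1) + (t / 2) * \<phi> (d, 0) = 0"
      unfolding eq by (simp add: linear_add[OF \<phi>(1)] linear_scale[OF \<phi>(1)] del: scaleR_Pair add_Pair)
    also have "\<dots> \<longleftrightarrow> t = - 2 * \<phi> (x, 1) / \<phi> (d, 0)"
      using \<phi>(2) by (auto simp: field_simps)
    finally show ?thesis .
  qed
  show ?thesis
    unfolding affine_reflection_def dir
  proof (rule the_equality, intro conjI)
    let ?t = "- 2 * \<phi> (x, 1) / \<phi> (d, 0)"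
    have eq: "x - (2 * \<phi> (x, 1) / \<phi> (d, 0)) *\<^sub>R d = x + ?t *\<^sub>R d"
      by simp
    show "\<exists>t. x - (2 * \<phi> (x, 1) / \<phi> (d, 0)) *\<^sub>R d = x + t *\<^sub>R d"
      using eq by blast
    show "ordinary (midpoint x (x - (2 * \<phi> (x, 1) / \<phi> (d, 0)) *\<^sub>R d)) \<in> m"
      unfolding eq mid ..
  qed (use mid in auto)
qed

lemma affine_ext_affine_reflection_hpoint:
  fixes \<phi> :: "(real^2) \<times> real \<Rightarrow> real" and d :: "real^2"
  assumes \<phi>: "linear \<phi>" "\<phi> (d, 0) \<noteq> 0"
    and m: "\<And>v. v \<noteq> 0 \<Longrightarrow> hpoint v \<in> m \<longleftrightarrow> \<phi> v = 0"
    and n: "n \<inter> line_at_infinity = {hpoint (d, 0)}"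
    and "v \<noteq> 0"
  shows "affine_ext (affine_reflection m n) (hpoint v) =
    hpoint (v - (2 * \<phi> v / \<phi> (d, 0)) *\<^sub>R (d, 0))"
proof (rule affine_ext_hpoint)
  have "linear (\<lambda>v. v - (2 * \<phi> v / c) *\<^sub>R e)" for c and e :: "(real^2) \<times> real"
    by (rule linearI)
      (simp_all add: linear_add[OF \<phi>(1)] linear_scale[OF \<phi>(1)] scaleR_diff_right
        distrib_left add_divide_distrib scaleR_add_left)
  then show "linear (\<lambda>v. v - (2 * \<phi> v / \<phi> (d, 0)) *\<^sub>R (d, 0))" .
  show "v \<noteq> 0"
    by fact
  show "(x, 1) - (2 * \<phi> (x, 1) / \<phi> (d, 0)) *\<^sub>R (d, 0) = (affine_reflection m n x, 1)" for x
    by (simp add: affine_reflection_eq[OF \<phi> m n])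
qed

section \<open>Barycentric coordinates\<close>

definition bary :: "real^2 \<Rightarrow> real^2 \<Rightarrow> real^2 \<Rightarrow> real \<Rightarrow> real \<Rightarrow> real \<Rightarrow> (real^2) \<times> real" where
  "bary A B C x y z = x *\<^sub>R (A, 1) + y *\<^sub>R (B, 1) + z *\<^sub>R (C, 1)"

lemma bary_cycle: "bary B C A y z x = bary A B C x y z"
  by (simp add: bary_def algebra_simps)

lemma snd_bary [simp]: "snd (bary A B C x y z) = x + y + z"
  by (simp add: bary_def)

lemma bary_add: "bary A B C x y z + bary A B C x' y' z' = bary A B C (x + x') (y + y') (z + z')"
  by (simp add: bary_def algebra_simps)

lemma bary_scaleR: "k *\<^sub>R bary A B C x y z = bary A B C (k * x) (k * y) (k * z)"
  by (simp add: bary_def algebra_simps)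

lemma bary_diff: "bary A B C x y z - bary A B C x' y' z' = bary A B C (x - x') (y - y') (z - z')"
  by (simp add: bary_def algebra_simps)

lemmas bary_arith = bary_add bary_scaleR bary_diff

lemma ordinary_vertices:
  "ordinary A = hpoint (bary A B C 1 0 0)"
  "ordinary B = hpoint (bary A B C 0 1 0)"
  "ordinary C = hpoint (bary A B C 0 0 1)"
  by (simp_all add: ordinary_eq_hpoint bary_def)

locale triangle =
  fixes A B C :: "real^2"
  assumes not_collinear: "\<not> collinear {A, B, C}"
begin

text \<open>
  For fixed vertices these equations terminate as rewrite rules, whereas the schematic
  \<open>bary_cycle\<close> applies to its own right-hand side. They carry results about the triangles \<open>BCA\<close>
  and \<open>CAB\<close> back to \<open>ABC\<close>.
\<close>

lemma bary_rotate:
  "bary B C A y z x = bary A B C x y z" "bary C A B z x y = bary A B C x y z"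
  by (simp_all add: bary_def algebra_simps)

lemma cycle: "triangle B C A"
  using not_collinear by unfold_locales (simp add: insert_commute)

lemma bary_eq_0_iff [simp]: "bary A B C x y z = 0 \<longleftrightarrow> x = 0 \<and> y = 0 \<and> z = 0"
proof
  assume "bary A B C x y z = 0"
  then have 0: "x *\<^sub>R A + y *\<^sub>R B + z *\<^sub>R C = 0" and y: "y = - x - z"
    by (auto simp: bary_def zero_prod_def)
  have 1: "x *\<^sub>R (A - B) + z *\<^sub>R (C - B) = 0"
    using 0 by (simp add: y algebra_simps)
  have nc: "\<not> collinear {0, A - B, C - B}"
    using not_collinear collinear_3[of A B C] by (simp add: NO_MATCH_def)
  have "z = 0"
  proof (rule ccontr)
    assume z: "z \<noteq> 0"
    have "C - B = (1 / z) *\<^sub>R (z *\<^sub>R (C - B))"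
      using z by simp
    also have "z *\<^sub>R (C - B) = (- x) *\<^sub>R (A - B)"
      using 1 by (simp add: eq_neg_iff_add_eq_0 add.commute)
    finally have "C - B = (- x / z) *\<^sub>R (A - B)"
      by simp
    then show False
      using nc collinear_lemma by blast
  qed
  moreover have "x = 0"
    using 1 nc calculation by (auto simp: insert_commute)
  ultimately show "x = 0 \<and> y = 0 \<and> z = 0"
    by (simp add: y)
qed (simp add: bary_def zero_prod_def)

lemma bary_eq_iff [simp]:
  "bary A B C x y z = bary A B C x' y' z' \<longleftrightarrow> x = x' \<and> y = y' \<and> z = z'"
  using bary_eq_0_iff[of "x - x'" "y - y'" "z - z'"] by (simp flip: bary_diff)

lemma vertices_basis:
  "independent {(A, 1 :: real), (B, 1), (C, 1)}" "card {(A, 1 :: real), (B, 1), (C, 1)} = 3"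
proof -
  have ne: "A \<noteq> B" "A \<noteq> C" "B \<noteq> C"
    using not_collinear by (auto simp: insert_commute)
  then show "card {(A, 1 :: real), (B, 1), (C, 1)} = 3"
    by auto
  show "independent {(A, 1 :: real), (B, 1), (C, 1)}"
    unfolding independent_explicit
  proof (intro conjI allI impI)
    fix u :: "(real^2) \<times> real \<Rightarrow> real"
    assume "(\<Sum>v\<in>{(A, 1), (B, 1), (C, 1)}. u v *\<^sub>R v) = 0"
    then have "bary A B C (u (A, 1)) (u (B, 1)) (u (C, 1)) = 0"
      using ne by (simp add: bary_def add.assoc del: scaleR_Pair add_Pair)
    then show "\<forall>v\<in>{(A, 1), (B, 1), (C, 1)}. u v = 0"
      by simp
  qed simp
qed

lemma bary_functional:
  obtains \<phi> where "linear \<phi>" "\<And>x y z. \<phi> (bary A B C x y z) = a * x + b * y + (c::real) * z"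
proof -
  have ne: "A \<noteq> B" "A \<noteq> C" "B \<noteq> C"
    using not_collinear by (auto simp: insert_commute)
  obtain \<phi> :: "(real^2) \<times> real \<Rightarrow> real" where \<phi>: "linear \<phi>"
    "\<forall>v \<in> {(A, 1), (B, 1), (C, 1)}. \<phi> v = (if v = (A, 1) then a else if v = (B, 1) then b else c)"
    using linear_independent_extend[OF vertices_basis(1),
        of "\<lambda>v. if v = (A, 1) then a else if v = (B, 1) then b else c"]
    by (elim exE conjE) (rule that)
  have "\<phi> (bary A B C x y z) = a * x + b * y + c * z" for x y z
    using \<phi>(2) ne
    by (simp add: bary_def linear_add[OF \<phi>(1)] linear_scale[OF \<phi>(1)] del: scaleR_Pair add_Pair)
  then show thesis
    using that \<phi>(1) by blast
qed

lemma bary_cases: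
  obtains x y z where "v = bary A B C x y z"
proof -
  have "dim {(A, 1 :: real), (B, 1), (C, 1)} = DIM((real^2) \<times> real)"
    using vertices_basis by (simp add: dim_eq_card_independent)
  then have "v \<in> span {(A, 1 :: real), (B, 1), (C, 1)}"
    by (metis UNIV_I dim_eq_full)
  then obtain x y z where "v - x *\<^sub>R (A, 1) - y *\<^sub>R (B, 1) = z *\<^sub>R (C, 1)"
    unfolding span_insert[of "(A, 1)"] span_insert[of "(B, 1)"] span_singleton by blast
  then have "v = z *\<^sub>R (C, 1) + y *\<^sub>R (B, 1) + x *\<^sub>R (A, 1)"
    by (simp only: diff_eq_eq)
  then have "v = bary A B C x y z"
    by (simp only: bary_def ac_simps)
  then show thesis
    using that by blast
qed

lemma hpoint_bary_cases:
  obtains x y z where "X = hpoint (bary A B C x y z)" "\<not> (x = 0 \<and> y = 0 \<and> z = 0)"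
  by (metis bary_cases bary_eq_0_iff hpoint_cases)

lemma barycentric_iff:
  "barycentric A B C X x y z \<longleftrightarrow> X = hpoint (bary A B C x y z) \<and> \<not> (x = 0 \<and> y = 0 \<and> z = 0)"
proof -
  obtain v where v: "v \<noteq> 0" "X = hpoint v"
    by (rule hpoint_cases)
  have "v \<in> Rep_epoint X"
    using v by (simp add: Rep_hpoint span_base)
  then have "Rep_epoint X \<noteq> span {0}"
    using v(1) by auto
  then have "barycentric A B C X x y z \<Longrightarrow> bary A B C x y z \<noteq> 0"
    unfolding barycentric_def bary_def[symmetric] by metis
  moreover have "Rep_epoint X = span {bary A B C x y z} \<longleftrightarrow> X = hpoint (bary A B C x y z)"
    if "bary A B C x y z \<noteq> 0"
    using Rep_hpoint[OF that] Rep_epoint_inject by metis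
  ultimately show ?thesis
    unfolding barycentric_def bary_def[symmetric] bary_eq_0_iff by blast
qed

lemma hpoint_bary_eqI:
  assumes "k \<noteq> 0" "x' = k * x" "y' = k * y" "z' = k * z"
  shows "hpoint (bary A B C x' y' z') = hpoint (bary A B C x y z)"
  using hpoint_scaleR[OF assms(1), of "bary A B C x y z"] assms by (simp add: bary_scaleR)

text \<open>
  A multiplicative \<open>f\<close> turns a rescaling of homogeneous coordinates by \<open>k\<close> into a rescaling by
  \<open>f k\<close>, so applying \<open>f\<close> to each coordinate does not depend on the chosen representative. The
  isotomic map and the barycentric square are the cases \<open>f x = 1 / x\<close> and \<open>f x = x\<^sup>2\<close>.
\<close>

lemma coordinatewise_map_hpoint:
  assumes mult: "\<And>k x. f (k * x) = f k * f x" and nz: "\<And>k. f k = 0 \<longleftrightarrow> k = (0 :: real)"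
    and "\<not> (p = 0 \<and> q = 0 \<and> r = 0)"
  shows "(THE Y. \<exists>x y z. barycentric A B C (hpoint (bary A B C p q r)) x y z \<and>
           barycentric A B C Y (f x) (f y) (f z)) = hpoint (bary A B C (f p) (f q) (f r))"
proof (rule the_equality)
  show "\<exists>x y z. barycentric A B C (hpoint (bary A B C p q r)) x y z \<and>
      barycentric A B C (hpoint (bary A B C (f p) (f q) (f r))) (f x) (f y) (f z)"
    using assms by (intro exI[of _ p] exI[of _ q] exI[of _ r]) (simp add: barycentric_iff)
next
  fix Y
  assume "\<exists>x y z. barycentric A B C (hpoint (bary A B C p q r)) x y z \<and>
      barycentric A B C Y (f x) (f y) (f z)"
  then obtain x y z where
    eq: "hpoint (bary A B C p q r) = hpoint (bary A B C x y z)" "\<not> (x = 0 \<and> y = 0 \<and> z = 0)"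
    and Y: "Y = hpoint (bary A B C (f x) (f y) (f z))"
    by (auto simp: barycentric_iff)
  obtain k where k: "k \<noteq> 0" "bary A B C x y z = k *\<^sub>R bary A B C p q r"
    using hpoint_eqD[OF eq(1)] eq(2) assms(3) by auto
  show "Y = hpoint (bary A B C (f p) (f q) (f r))"
    unfolding Y
    by (rule hpoint_bary_eqI[of "f k"]) (use k nz mult in \<open>auto simp: bary_scaleR\<close>)
qed

text \<open>
  Adding multiples of \<open>A\<close> changes only the first coordinate, so lines through \<open>A\<close> are
  distinguished by the ratio of the other two. This covers the cevians, the axis \<open>AQ\<close> and, with a
  second vertex in place of \<open>(x : y : z)\<close>, the sidelines.
\<close>

lemma mem_join_vertex_iff:
  assumes "y \<noteq> 0 \<or> z \<noteq> 0" "\<not> (x' = 0 \<and> y' = 0 \<and> z' = 0)"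
  shows "hpoint (bary A B C x' y' z') \<in> join (ordinary A) (hpoint (bary A B C x y z)) \<longleftrightarrow>
    y' * z = z' * y"
proof -
  have "hpoint (bary A B C x' y' z') \<in> join (ordinary A) (hpoint (bary A B C x y z)) \<longleftrightarrow>
      (\<exists>i j. x' = i + j * x \<and> y' = j * y \<and> z' = j * z)"
    using assms unfolding ordinary_vertices(1)[of A B C]
    by (subst hpoint_mem_join_iff) (auto simp: bary_arith)
  also have "\<dots> \<longleftrightarrow> (\<exists>j. y' = j * y \<and> z' = j * z)"
    by (metis diff_add_cancel)
  also have "\<dots> \<longleftrightarrow> y' * z = z' * y"
  proof
    assume eq: "y' * z = z' * y"
    show "\<exists>j. y' = j * y \<and> z' = j * z"
    proof (cases "y = 0")
      case True
      then show ?thesis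
        using assms(1) eq by (intro exI[of _ "z' / z"]) auto
    next
      case False
      then show ?thesis
        using eq by (intro exI[of _ "y' / y"]) (auto simp: field_simps)
    qed
  qed auto
  finally show ?thesis .
qed

lemma mem_sideline_iff:
  assumes "\<not> (x = 0 \<and> y = 0 \<and> z = 0)"
  shows "hpoint (bary A B C x y z) \<in> join (ordinary B) (ordinary C) \<longleftrightarrow> x = 0"
  using triangle.mem_join_vertex_iff[OF cycle, of 1 0 y z x 0] assms
  unfolding ordinary_vertices(3)[where A = A and B = B and C = C] bary_rotate by auto

lemma mem_sides_iff:
  assumes "\<not> (x = 0 \<and> y = 0 \<and> z = 0)"
  shows "hpoint (bary A B C x y z) \<in> sides A B C \<longleftrightarrow> x = 0 \<or> y = 0 \<or> z = 0"
  using mem_sideline_iff[of x y z] triangle.mem_sideline_iff[OF cycle, of y z x]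
    triangle.mem_sideline_iff[OF triangle.cycle[OF cycle], of z x y] assms
  by (auto simp: sides_def bary_rotate)

lemma affine_ext_complement:
  assumes "\<not> (x = 0 \<and> y = 0 \<and> z = 0)"
  shows "affine_ext (complement A B C) (hpoint (bary A B C x y z)) =
    hpoint (bary A B C (y + z) (z + x) (x + y))"
proof -
  \<comment> \<open>\<open>bary A B C 1 1 1\<close> is three times the centroid, so \<open>?T\<close> preserves the height \<open>snd v\<close>.\<close>
  let ?T = "\<lambda>v. (- 1 / 2) *\<^sub>R v + (snd v / 2) *\<^sub>R bary A B C 1 1 1"
  have "affine_ext (complement A B C) (hpoint (bary A B C x y z)) = hpoint (?T (bary A B C x y z))"
  proof (rule affine_ext_hpoint)
    have "linear (\<lambda>v. (- 1 / 2) *\<^sub>R v + (snd v / 2) *\<^sub>R e)" for e :: "(real^2) \<times> real"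
      by (rule linearI) (simp_all add: scaleR_add_right scaleR_add_left scaleR_diff_right add_divide_distrib)
    then show "linear ?T" .
    show "?T (a, 1) = (complement A B C a, 1)" for a
    proof -
      have "(1 / 2) *\<^sub>R v = (1 / 3) *\<^sub>R v + (1 / 6) *\<^sub>R v" for v :: "real^2"
        by (simp flip: scaleR_add_left)
      from this[of "A + B + C"] show ?thesis
        by (simp add: bary_def complement_def Let_def scaleR_add_right scaleR_diff_right)
    qed
  qed (use assms in simp)
  also have "?T (bary A B C x y z) = (1 / 2) *\<^sub>R bary A B C (y + z) (z + x) (x + y)"
    by (simp add: bary_arith field_simps)
  finally show ?thesis
    by (simp add: hpoint_scaleR)
qed

lemma pointQ_hpoint:
  assumes "p \<noteq> 0" "q \<noteq> 0" "r \<noteq> 0"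
  shows "pointQ A B C (hpoint (bary A B C p q r)) =
    hpoint (bary A B C (p * (q + r)) (q * (r + p)) (r * (p + q)))"
proof -
  have "isotomic A B C (hpoint (bary A B C p q r)) = hpoint (bary A B C (1/p) (1/q) (1/r))"
    unfolding isotomic_def using assms
    by (intro coordinatewise_map_hpoint[of "\<lambda>x. 1 / x"]) auto
  then have "pointQ A B C (hpoint (bary A B C p q r)) =
      hpoint (bary A B C (1/q + 1/r) (1/r + 1/p) (1/p + 1/q))"
    unfolding pointQ_def using assms by (simp add: affine_ext_complement)
  also have "\<dots> = hpoint (bary A B C (p * (q + r)) (q * (r + p)) (r * (p + q)))"
    by (rule hpoint_bary_eqI[of "1 / (p * q * r)"]) (use assms in \<open>auto simp: field_simps\<close>)
  finally show ?thesis .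
qed

lemma barycentric_square_hpoint:
  assumes "\<not> (x = 0 \<and> y = 0 \<and> z = 0)"
  shows "barycentric_square A B C (hpoint (bary A B C x y z)) = hpoint (bary A B C (x\<^sup>2) (y\<^sup>2) (z\<^sup>2))"
  unfolding barycentric_square_def using assms
  by (intro coordinatewise_map_hpoint[of "\<lambda>x. x\<^sup>2"]) (auto simp: power_mult_distrib)

lemma traceD_hpoint:
  assumes "q \<noteq> 0 \<or> r \<noteq> 0"
  shows "traceD A B C (hpoint (bary A B C p q r)) = hpoint (bary A B C 0 q r)"
  unfolding traceD_def
proof (rule meet_eqI)
  show "hpoint (bary A B C 0 q r) \<in> join (ordinary A) (hpoint (bary A B C p q r))"
    using assms by (subst mem_join_vertex_iff) auto
  show "hpoint (bary A B C 0 q r) \<in> join (ordinary B) (ordinary C)"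
    using assms by (subst mem_sideline_iff) auto
next
  fix Z
  assume Z: "Z \<in> join (ordinary A) (hpoint (bary A B C p q r))"
    "Z \<in> join (ordinary B) (ordinary C)"
  obtain x y z where xyz: "Z = hpoint (bary A B C x y z)" "\<not> (x = 0 \<and> y = 0 \<and> z = 0)"
    by (rule hpoint_bary_cases)
  have x: "x = 0" and yz: "y * r = z * q"
    using Z xyz assms by (auto simp: mem_sideline_iff mem_join_vertex_iff)
  show "Z = hpoint (bary A B C 0 q r)"
  proof (cases "q = 0")
    case True
    then show ?thesis
      unfolding xyz using xyz(2) x yz assms by (intro hpoint_bary_eqI[of "z / r"]) auto
  next
    case False
    then show ?thesis
      unfolding xyz using xyz(2) x yz assms
      by (intro hpoint_bary_eqI[of "y / q"]) (auto simp: field_simps)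
  qed
qed

end

section \<open>The reflections in barycentric coordinates\<close>

text \<open>
  Replacing \<open>ABC\<close> by \<open>BCA\<close> permutes the traces and fixes \<open>Q\<close>, so \<open>h\<^sub>b\<close> and \<open>h\<^sub>c\<close> are the
  maps \<open>h\<^sub>a\<close> of the rotated triangles.
\<close>

lemma cyclic_traces:
  "traceE A B C P = traceD B C A P" "traceF A B C P = traceD C A B P"
  by (simp_all add: traceD_def traceE_def traceF_def)

lemma cyclic_pointQ: "pointQ B C A P = pointQ A B C P"
proof -
  have "B + C + A = A + B + C"
    by (simp add: algebra_simps)
  then have "complement B C A = complement A B C"
    by (simp only: fun_eq_iff complement_def simp_thms)
  moreover have "isotomic B C A P = isotomic A B C P"
  proof -
    have bar: "barycentric B C A X y z x = barycentric A B C X x y z" for X x y z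
      by (simp only: barycentric_def bary_def[symmetric] bary_cycle[of B C A y z x])
    show ?thesis
      unfolding isotomic_def bar[symmetric] by metis
  qed
  ultimately show ?thesis
    by (simp add: pointQ_def)
qed

lemma reflB_eq_reflA: "reflB A B C P = reflA B C A P"
  unfolding reflB_def reflA_def cyclic_traces cyclic_pointQ[of B C A]
  by (simp only: join_commute[of "traceD A B C P"])

lemma reflC_eq_reflA: "reflC A B C P = reflA C A B P"
  unfolding reflC_def reflA_def cyclic_traces cyclic_pointQ[of C A B] cyclic_pointQ[of B C A] ..

context triangle
begin

text \<open>
  The axis \<open>AQ\<close> is the zero set of \<open>w y - v z\<close>, and the point at infinity of \<open>EF\<close> is
  \<open>(p (q - r) : - v : w)\<close>, where this form takes the value \<open>- 2 v w \<noteq> 0\<close>. The first coordinate of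
  the image does not affect its join with \<open>A\<close>, so it is left unspecified.
\<close>

lemma reflA_hpoint:
  assumes pqr: "p \<noteq> 0" "q \<noteq> 0" "r \<noteq> 0" and sums: "r + p \<noteq> 0" "p + q \<noteq> 0"
    and xyz: "\<not> (x = 0 \<and> y = 0 \<and> z = 0)"
  defines "v \<equiv> q * (r + p)" and "w \<equiv> r * (p + q)"
  obtains t where "reflA A B C (hpoint (bary A B C p q r)) (hpoint (bary A B C x y z)) =
    hpoint (bary A B C t (v * z / w) (w * y / v))"
proof -
  let ?P = "hpoint (bary A B C p q r)"
  have vw: "v \<noteq> 0" "w \<noteq> 0"
    using pqr sums by (auto simp: v_def w_def)
  define e where "e = p * (q - r)"
  define d where "d = fst (bary A B C e (- v) w)"
  have d: "(d, 0) = bary A B C e (- v) w"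
    unfolding d_def by (rule prod_eqI) (simp_all add: e_def v_def w_def algebra_simps)
  obtain \<phi> where \<phi>: "linear \<phi>" "\<And>x y z. \<phi> (bary A B C x y z) = 0 * x + w * y + (- v) * z"
    using bary_functional[of 0 w "- v"] by blast
  have \<phi>d: "\<phi> (d, 0) = - 2 * (v * w)"
    by (simp add: d \<phi>(2))
  have m: "hpoint u \<in> join (ordinary A) (pointQ A B C ?P) \<longleftrightarrow> \<phi> u = 0" if "u \<noteq> 0" for u
  proof -
    obtain x y z where u: "u = bary A B C x y z"
      by (rule bary_cases)
    show ?thesis
      using that vw unfolding u pointQ_hpoint[OF pqr] v_def[symmetric] w_def[symmetric]
      by (subst mem_join_vertex_iff) (auto simp: \<phi>(2) algebra_simps)
  qed
  have E: "traceE A B C ?P = hpoint (bary A B C p 0 r)"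
    using triangle.traceD_hpoint[OF cycle, of r p q] pqr
    by (simp add: cyclic_traces bary_rotate)
  have F: "traceF A B C ?P = hpoint (bary A B C p q 0)"
    using triangle.traceD_hpoint[OF triangle.cycle[OF cycle], of p q r] pqr
    by (simp add: cyclic_traces bary_rotate)
  have EF: "hpoint u \<in> join (traceE A B C ?P) (traceF A B C ?P) \<longleftrightarrow>
      (\<exists>i j. u = i *\<^sub>R bary A B C p 0 r + j *\<^sub>R bary A B C p q 0)" if "u \<noteq> 0" for u
    unfolding E F using that pqr by (intro hpoint_mem_join_iff) auto
  have d0: "(d, 0::real) \<noteq> 0"
    unfolding d using vw by simp
  have n: "join (traceE A B C ?P) (traceF A B C ?P) \<inter> line_at_infinity = {hpoint (d, 0)}"
  proof (intro equalityI subsetI)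
    fix X
    assume X: "X \<in> join (traceE A B C ?P) (traceF A B C ?P) \<inter> line_at_infinity"
    obtain u where u: "u \<noteq> 0" "X = hpoint u"
      by (rule hpoint_cases)
    obtain i j where ij: "u = i *\<^sub>R bary A B C p 0 r + j *\<^sub>R bary A B C p q 0"
      using X EF u by blast
    have "i * (r + p) + j * (p + q) = 0"
      using X u by (simp add: hpoint_mem_line_at_infinity_iff) (simp add: ij algebra_simps)
    \<comment> \<open>Heights cancel exactly for multiples of \<open>(p + q) E - (r + p) F\<close>, which is the vector \<open>(d, 0)\<close>.\<close>
    then have j: "j = - (i / (p + q)) * (r + p)" and i: "i = (i / (p + q)) * (p + q)"
      using sums by (simp_all add: field_simps)
    have "u = (i / (p + q)) *\<^sub>R (d, 0)"
      unfolding ij d bary_arith bary_eq_iff using i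
      by (simp add: j e_def v_def w_def) (use sums in \<open>simp add: field_simps\<close>)
    moreover from this have "i / (p + q) \<noteq> 0"
      using u(1) by (metis scaleR_zero_left)
    ultimately show "X \<in> {hpoint (d, 0)}"
      unfolding u by (metis hpoint_scaleR singletonI)
  next
    fix X
    assume "X \<in> {hpoint (d, 0)}"
    moreover have "(d, 0) = (p + q) *\<^sub>R bary A B C p 0 r + (- (r + p)) *\<^sub>R bary A B C p q 0"
      unfolding d bary_arith bary_eq_iff by (simp add: e_def v_def w_def algebra_simps)
    then have "hpoint (d, 0) \<in> join (traceE A B C ?P) (traceF A B C ?P)"
      using EF[OF d0] by blast
    moreover have "hpoint (d, 0) \<in> line_at_infinity"
      using hpoint_mem_line_at_infinity_iff[OF d0] by simp
    ultimately show "X \<in> join (traceE A B C ?P) (traceF A B C ?P) \<inter> line_at_infinity"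
      by blast
  qed
  define s where "s = (w * y - v * z) / (v * w)"
  have "reflA A B C ?P (hpoint (bary A B C x y z)) =
      hpoint (bary A B C x y z - (2 * \<phi> (bary A B C x y z) / \<phi> (d, 0)) *\<^sub>R (d, 0))"
    unfolding reflA_def
    by (rule affine_ext_affine_reflection_hpoint[OF \<phi>(1) _ m n]) (use \<phi>d vw xyz in auto)
  also have "2 * \<phi> (bary A B C x y z) / \<phi> (d, 0) = - s"
    using vw by (simp add: \<phi>(2) \<phi>d s_def field_simps)
  also have "bary A B C x y z - (- s) *\<^sub>R (d, 0) = bary A B C (x + s * e) (v * z / w) (w * y / v)"
    unfolding d bary_arith bary_eq_iff using vw by (simp add: s_def field_simps)
  finally show thesis
    by (rule that)
qed

lemma mem_join_reflA_iff:
  assumes pqr: "p \<noteq> 0" "q \<noteq> 0" "r \<noteq> 0" and sums: "r + p \<noteq> 0" "p + q \<noteq> 0"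
    and "y \<noteq> 0 \<or> z \<noteq> 0" "\<not> (x' = 0 \<and> y' = 0 \<and> z' = 0)"
  shows "hpoint (bary A B C x' y' z') \<in>
      join (ordinary A) (reflA A B C (hpoint (bary A B C p q r)) (hpoint (bary A B C x y z))) \<longleftrightarrow>
    y' * y / (q * (r + p))\<^sup>2 = z' * z / (r * (p + q))\<^sup>2"
proof -
  define v where "v = q * (r + p)"
  define w where "w = r * (p + q)"
  have vw: "v \<noteq> 0" "w \<noteq> 0"
    using pqr sums by (auto simp: v_def w_def)
  obtain t where t: "reflA A B C (hpoint (bary A B C p q r)) (hpoint (bary A B C x y z)) =
      hpoint (bary A B C t (v * z / w) (w * y / v))"
    using reflA_hpoint[OF pqr sums, of x y z] assms(6) unfolding v_def w_def by metis
  have "hpoint (bary A B C x' y' z') \<in> join (ordinary A) (hpoint (bary A B C t (v * z / w) (w * y / v)))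
      \<longleftrightarrow> y' * (w * y / v) = z' * (v * z / w)"
    using assms(6,7) vw by (intro mem_join_vertex_iff) auto
  also have "\<dots> \<longleftrightarrow> y' * y / v\<^sup>2 = z' * z / w\<^sup>2"
    using vw by (simp add: field_simps power2_eq_square)
  finally show ?thesis
    by (simp add: t v_def w_def)
qed

lemma anticomplementary_sides_eq:
  "anticomplementary_sides A B C = sides (B + C - A) (C + A - B) (A + B - C)"
proof -
  have "inv (complement A B C) = (\<lambda>x. A + B + C - 2 *\<^sub>R x)"
    by (rule inv_unique_comp)
      (simp_all add: fun_eq_iff complement_def Let_def algebra_simps flip: scaleR_add_left)
  then show ?thesis
    by (simp add: anticomplementary_sides_def algebra_simps scaleR_2)
qed

text \<open>
  The line \<open>y + z = 0\<close> passes through \<open>C + A - B = (1 : -1 : 1)\<close> and \<open>A + B - C = (1 : 1 : -1)\<close>,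
  two vertices of the anticomplementary triangle.
\<close>

lemma mem_anticomplementary_sideline:
  assumes "q + r = 0" "\<not> (p = 0 \<and> q = 0 \<and> r = 0)"
  shows "hpoint (bary A B C p q r) \<in> join (ordinary (C + A - B)) (ordinary (A + B - C))"
proof -
  have "ordinary (C + A - B) = hpoint (bary A B C 1 (- 1) 1)"
    "ordinary (A + B - C) = hpoint (bary A B C 1 1 (- 1))"
    by (simp_all add: ordinary_eq_hpoint bary_def algebra_simps)
  moreover have "hpoint (bary A B C p q r) \<in>
      join (hpoint (bary A B C 1 (- 1) 1)) (hpoint (bary A B C 1 1 (- 1)))"
  proof (subst hpoint_mem_join_iff)
    have "bary A B C p q r =
        ((p - q) / 2) *\<^sub>R bary A B C 1 (- 1) 1 + ((p + q) / 2) *\<^sub>R bary A B C 1 1 (- 1)"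
      unfolding bary_arith bary_eq_iff using assms(1) by (simp add: field_simps)
    then show "\<exists>i j. bary A B C p q r = i *\<^sub>R bary A B C 1 (- 1) 1 + j *\<^sub>R bary A B C 1 1 (- 1)"
      by blast
  qed (use assms(2) in simp_all)
  ultimately show ?thesis
    by simp
qed

lemma sums_nonzero_if_not_mem_anticomplementary_sides:
  assumes "hpoint (bary A B C p q r) \<notin> anticomplementary_sides A B C"
    "\<not> (p = 0 \<and> q = 0 \<and> r = 0)"
  shows "q + r \<noteq> 0" "r + p \<noteq> 0" "p + q \<noteq> 0"
  using assms mem_anticomplementary_sideline[of q r p]
    triangle.mem_anticomplementary_sideline[OF cycle, of r p q]
    triangle.mem_anticomplementary_sideline[OF triangle.cycle[OF cycle], of p q r]
  by (auto simp: anticomplementary_sides_eq sides_def bary_rotate)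

end

section \<open>Concurrence of the reflected cevians\<close>

text \<open>
  At least two of \<open>x\<close>, \<open>y\<close>, \<open>z\<close> are nonzero, and the third may vanish. The factor \<open>k\<close> is read off
  from a coordinate of \<open>(a y z, b z x, c x y)\<close> in which two nonzero ones are multiplied; the
  equations then force the other coordinates.
\<close>

lemma reciprocal_proportional:
  fixes a b c x y z x' y' z' :: real
  assumes "a \<noteq> 0" "b \<noteq> 0" "c \<noteq> 0" and "\<not> (x' = 0 \<and> y' = 0 \<and> z' = 0)"
    and "y \<noteq> 0 \<or> z \<noteq> 0" "z \<noteq> 0 \<or> x \<noteq> 0" "x \<noteq> 0 \<or> y \<noteq> 0"
    and eq: "x' * x / a = y' * y / b" "y' * y / b = z' * z / c"
  obtains k where "k \<noteq> 0" "x' = k * (a * y * z)" "y' = k * (b * z * x)" "z' = k * (c * x * y)"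
proof -
  have "x' * x / a = z' * z / c"
    using eq by simp
  then have eq': "b * (x' * x) = a * (y' * y)" "c * (y' * y) = b * (z' * z)" "a * (z' * z) = c * (x' * x)"
    using assms(1-3) eq by (simp_all add: field_simps)
  have "\<exists>k. x' = k * (a * y * z) \<and> y' = k * (b * z * x) \<and> z' = k * (c * x * y)"
  proof -
    consider "y \<noteq> 0" "z \<noteq> 0" | "z \<noteq> 0" "x \<noteq> 0" | "x \<noteq> 0" "y \<noteq> 0"
      using assms(5-7) by blast
    then show ?thesis
    proof cases
      case 1
      then show ?thesis
        using assms(1-3) eq' by (intro exI[of _ "x' / (a * y * z)"]) (auto simp: field_simps)
    next
      case 2
      then show ?thesis
        using assms(1-3) eq' by (intro exI[of _ "y' / (b * z * x)"]) (auto simp: field_simps)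
    next
      case 3
      then show ?thesis
        using assms(1-3) eq' by (intro exI[of _ "z' / (c * x * y)"]) (auto simp: field_simps)
    qed
  qed
  then obtain k where "x' = k * (a * y * z)" "y' = k * (b * z * x)" "z' = k * (c * x * y)"
    by blast
  moreover from this have "k \<noteq> 0"
    using assms(4) by auto
  ultimately show thesis
    using that by blast
qed

context triangle
begin

text \<open>
  Each of the three lines contributes an equality between two of the ratios \<open>x x' / a\<close>, \<open>y y' / b\<close>,
  \<open>z z' / c\<close>, where \<open>a\<close>, \<open>b\<close>, \<open>c\<close> are the squares of the coordinates of \<open>Q\<close>. Any two of these
  equalities imply the third, which is why the lines concur.
\<close>

lemma isogonal_common_point_iff:
  assumes pqr: "p \<noteq> 0" "q \<noteq> 0" "r \<noteq> 0" and sums: "q + r \<noteq> 0" "r + p \<noteq> 0" "p + q \<noteq> 0"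
    and X: "hpoint (bary A B C x y z) \<notin> {ordinary A, ordinary B, ordinary C}"
    and xyz: "\<not> (x = 0 \<and> y = 0 \<and> z = 0)"
  shows "isogonal_common_point A B C (hpoint (bary A B C p q r)) (hpoint (bary A B C x y z)) Y \<longleftrightarrow>
    Y = hpoint (bary A B C ((p * (q + r))\<^sup>2 * y * z) ((q * (r + p))\<^sup>2 * z * x) ((r * (p + q))\<^sup>2 * x * y))"
proof -
  define a where "a = (p * (q + r))\<^sup>2"
  define b where "b = (q * (r + p))\<^sup>2"
  define c where "c = (r * (p + q))\<^sup>2"
  have abc: "a \<noteq> 0" "b \<noteq> 0" "c \<noteq> 0"
    using pqr sums by (auto simp: a_def b_def c_def)
  have two: "y \<noteq> 0 \<or> z \<noteq> 0" "z \<noteq> 0 \<or> x \<noteq> 0" "x \<noteq> 0 \<or> y \<noteq> 0"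
    using X xyz hpoint_bary_eqI[of x x 1 y 0 z 0] hpoint_bary_eqI[of y x 0 y 1 z 0]
      hpoint_bary_eqI[of z x 0 y 0 z 1]
    by (auto simp: ordinary_vertices[where A = A and B = B and C = C])
  have iff: "isogonal_common_point A B C (hpoint (bary A B C p q r)) (hpoint (bary A B C x y z))
        (hpoint (bary A B C x' y' z')) \<longleftrightarrow> x' * x / a = y' * y / b \<and> y' * y / b = z' * z / c"
    if "\<not> (x' = 0 \<and> y' = 0 \<and> z' = 0)" for x' y' z'
  proof -
    have "hpoint (bary A B C x' y' z') \<in>
        join (ordinary A) (reflA A B C (hpoint (bary A B C p q r)) (hpoint (bary A B C x y z)))
        \<longleftrightarrow> y' * y / b = z' * z / c"
      unfolding b_def c_def by (rule mem_join_reflA_iff) (use pqr sums two that in auto)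
    moreover have "hpoint (bary A B C x' y' z') \<in>
        join (ordinary B) (reflB A B C (hpoint (bary A B C p q r)) (hpoint (bary A B C x y z)))
        \<longleftrightarrow> z' * z / c = x' * x / a"
      unfolding c_def a_def reflB_eq_reflA
      using triangle.mem_join_reflA_iff[OF cycle, of q r p z x y' z' x' y] pqr sums two that
      unfolding bary_rotate by blast
    moreover have "hpoint (bary A B C x' y' z') \<in>
        join (ordinary C) (reflC A B C (hpoint (bary A B C p q r)) (hpoint (bary A B C x y z)))
        \<longleftrightarrow> x' * x / a = y' * y / b"
      unfolding a_def b_def reflC_eq_reflA
      using triangle.mem_join_reflA_iff[OF triangle.cycle[OF cycle], of r p q x y z' x' y' z]
        pqr sums two that
      unfolding bary_rotate by blast
    ultimately show ?thesis
      unfolding isogonal_common_point_def by auto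
  qed
  have nz: "\<not> (a * y * z = 0 \<and> b * z * x = 0 \<and> c * x * y = 0)"
    using abc two by auto
  have "isogonal_common_point A B C (hpoint (bary A B C p q r)) (hpoint (bary A B C x y z)) Y \<longleftrightarrow>
    Y = hpoint (bary A B C (a * y * z) (b * z * x) (c * x * y))"
  proof
    assume *: "isogonal_common_point A B C (hpoint (bary A B C p q r)) (hpoint (bary A B C x y z)) Y"
    obtain x' y' z' where Y: "Y = hpoint (bary A B C x' y' z')" "\<not> (x' = 0 \<and> y' = 0 \<and> z' = 0)"
      by (rule hpoint_bary_cases)
    have "x' * x / a = y' * y / b" "y' * y / b = z' * z / c"
      using * unfolding Y(1) iff[OF Y(2)] by auto
    then obtain k where "k \<noteq> 0" "x' = k * (a * y * z)" "y' = k * (b * z * x)" "z' = k * (c * x * y)"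
      using reciprocal_proportional[OF abc Y(2) two] by metis
    then show "Y = hpoint (bary A B C (a * y * z) (b * z * x) (c * x * y))"
      unfolding Y(1) by (rule hpoint_bary_eqI)
  next
    assume "Y = hpoint (bary A B C (a * y * z) (b * z * x) (c * x * y))"
    then show "isogonal_common_point A B C (hpoint (bary A B C p q r)) (hpoint (bary A B C x y z)) Y"
      using iff[OF nz] abc by simp
  qed
  then show ?thesis
    by (simp add: a_def b_def c_def)
qed

end

theorem proposition2p9:
  fixes A B C :: "real^2" and P :: epoint
  assumes "\<not> collinear {A, B, C}"
    and "P \<notin> sides A B C"
    and "P \<notin> anticomplementary_sides A B C"
  shows "(\<forall>X. X \<notin> {ordinary A, ordinary B, ordinary C} \<longrightarrow>
            (\<exists>!Y. isogonal_common_point A B C P X Y)) \<and>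
         reciprocal_conjugation A B C (barycentric_square A B C (pointQ A B C P))
           (generalized_isogonal A B C P)"
proof -
  interpret triangle A B C
    by unfold_locales fact
  obtain p q r where P: "P = hpoint (bary A B C p q r)" and 0: "\<not> (p = 0 \<and> q = 0 \<and> r = 0)"
    by (rule hpoint_bary_cases)
  have pqr: "p \<noteq> 0" "q \<noteq> 0" "r \<noteq> 0"
    using assms(2) 0 by (simp_all add: P mem_sides_iff)
  have sums: "q + r \<noteq> 0" "r + p \<noteq> 0" "p + q \<noteq> 0"
    using sums_nonzero_if_not_mem_anticomplementary_sides assms(3) 0 unfolding P by blast+
  define l where "l = (p * (q + r))\<^sup>2"
  define m where "m = (q * (r + p))\<^sup>2"
  define n where "n = (r * (p + q))\<^sup>2"
  have lmn: "l \<noteq> 0" "m \<noteq> 0" "n \<noteq> 0"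
    using pqr sums by (auto simp: l_def m_def n_def)
  have common: "isogonal_common_point A B C P (hpoint (bary A B C x y z)) Y \<longleftrightarrow>
      Y = hpoint (bary A B C (l * y * z) (m * z * x) (n * x * y))"
    if "hpoint (bary A B C x y z) \<notin> {ordinary A, ordinary B, ordinary C}"
      "\<not> (x = 0 \<and> y = 0 \<and> z = 0)" for x y z Y
    unfolding P l_def m_def n_def using pqr sums that by (rule isogonal_common_point_iff)
  have unique: "\<exists>!Y. isogonal_common_point A B C P X Y"
    if "X \<notin> {ordinary A, ordinary B, ordinary C}" for X
  proof -
    obtain x y z where "X = hpoint (bary A B C x y z)" "\<not> (x = 0 \<and> y = 0 \<and> z = 0)"
      by (rule hpoint_bary_cases)
    then show ?thesis
      using that common by simp
  qed
  have pole: "barycentric A B C (barycentric_square A B C (pointQ A B C P)) l m n"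
    using pqr sums lmn
    by (simp add: P pointQ_hpoint barycentric_square_hpoint barycentric_iff l_def m_def n_def)
  have conj: "barycentric A B C (generalized_isogonal A B C P X) (l / x) (m / y) (n / z)"
    if X: "X \<notin> sides A B C" and "barycentric A B C X x y z" for X x y z
  proof -
    have X_eq: "X = hpoint (bary A B C x y z)" and "\<not> (x = 0 \<and> y = 0 \<and> z = 0)"
      using that by (simp_all add: barycentric_iff)
    then have xyz: "x \<noteq> 0" "y \<noteq> 0" "z \<noteq> 0"
      using X by (simp_all add: mem_sides_iff)
    have "{ordinary A, ordinary B, ordinary C} \<subseteq> sides A B C"
      unfolding ordinary_vertices[where A = A and B = B and C = C]
      by (simp add: mem_sides_iff)
    then have "hpoint (bary A B C x y z) \<notin> {ordinary A, ordinary B, ordinary C}"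
      using X X_eq by blast
    then have "generalized_isogonal A B C P X =
        hpoint (bary A B C (l * y * z) (m * z * x) (n * x * y))"
      unfolding generalized_isogonal_def X_eq
      by (intro the_equality) (simp_all add: common xyz)
    also have "\<dots> = hpoint (bary A B C (l / x) (m / y) (n / z))"
      by (rule hpoint_bary_eqI[of "x * y * z"]) (use xyz in auto)
    finally show ?thesis
      using lmn xyz by (simp add: barycentric_iff)
  qed
  show ?thesis
    unfolding reciprocal_conjugation_def using unique pole conj lmn by (metis mult_eq_0_iff)
qed

end
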